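(* Let $C$ be an $[n,k]$ code over $\mathbb{F}_q$ with $d(C^\perp)=3$. Then $\gamma(C)=k$ $(=k-d(C^\perp)+3)$ if and only if $C$ is monomially equivalent to a dual Hamming code.
   Context: An $[n,k]$ code over $\mathbb{F}_q$ is a $k$-dimensional subspace $C\subseteq\mathbb{F}_q^n$; write $E=\{1,\dots,n\}$. For $\bm{x}\in\mathbb{F}_q^n$, $\mathrm{supp}(\bm{x})=\{i: x_i\neq 0\}$ and the weight is $|\mathrm{supp}(\bm{x})|$; for $B\subseteq\mathbb{F}_q^n$, $\mathrm{Supp}(B)=\bigcup_{\bm{x}\in B}\mathrm{supp}(\bm{x})$. $C^\perp$ is the dual code with respect to the standard inner product and $d(C^\perp)$ is the minimum weight of a nonzero codeword of $C^\perp$. The covering dimension is $\gamma(C)=\infty$ if $\mathrm{Supp}(C)\neq E$, and otherwise $\gamma(C)$ is the least positive integer $r$ such that $C$ has an $r$-dimensional subspace $D$ with $\mathrm{Supp}(D)=E$. A dual Hamming code is an $[(q^k-1)/(q-1),k]$ code over $\mathbb{F}_q$ with a generator matrix whose columns consist of exactly one nonzero vector from each one-dimensional subspace of $\mathbb{F}_q^k$. Two codes are monomially equivalent if one is obtained from the other by permuting coordinates and multiplying coordinates by nonzero scalars. *)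

theory Defs
  imports "HOL-Analysis.Analysis" "HOL-Library.Extended_Nat"
begin

text \<open>Vectors of F_q^n are elements of type 'a ^ 'n, where 'a is a finite field
  and the coordinate set E is the finite type 'n (so n = CARD('n)).
  A linear code is a subspace w.r.t. the scalar multiplication (*s).\<close>

definition supp :: "'a::zero ^ 'n \<Rightarrow> 'n set" where
  "supp x = {i. x $ i \<noteq> 0}"

definition Supp :: "('a::zero ^ 'n) set \<Rightarrow> 'n set" where
  "Supp B = (\<Union>x\<in>B. supp x)"

definition wt :: "'a::zero ^ 'n::finite \<Rightarrow> nat" where
  "wt x = card (supp x)"

definition dual_code :: "('a::field ^ 'n::finite) set \<Rightarrow> ('a ^ 'n) set" where
  "dual_code C = {y. \<forall>x\<in>C. (\<Sum>j\<in>UNIV. x $ j * y $ j) = 0}"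

text \<open>Minimum weight of a nonzero codeword (convention: 0 for the zero code).\<close>
definition min_wt :: "('a::zero ^ 'n::finite) set \<Rightarrow> nat" where
  "min_wt C = (if \<exists>x\<in>C. x \<noteq> 0 then Min {wt x | x. x \<in> C \<and> x \<noteq> 0} else 0)"

definition covering_dim :: "('a::field ^ 'n::finite) set \<Rightarrow> enat" where
  "covering_dim C =
     (if Supp C \<noteq> UNIV then \<infinity>
      else enat (LEAST r. r > 0 \<and>
              (\<exists>D. vec.subspace D \<and> D \<subseteq> C \<and> vec.dim D = r \<and> Supp D = UNIV)))"

text \<open>D is obtained from C by permuting coordinates and multiplying
  coordinates by nonzero scalars.\<close>
definition monomially_equivalent :: "('a::field ^ 'n::finite) set \<Rightarrow> ('a ^ 'n) set \<Rightarrow> bool" where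
  "monomially_equivalent C D \<longleftrightarrow>
     (\<exists>\<sigma> :: 'n \<Rightarrow> 'n. \<exists>s :: 'n \<Rightarrow> 'a. bij \<sigma> \<and> (\<forall>j. s j \<noteq> 0) \<and>
        D = (\<lambda>x. \<chi> j. s j * x $ \<sigma> j) ` C)"

text \<open>Dual Hamming code of dimension k over the field 'a (q = CARD('a)):
  a [(q^k-1)/(q-1), k] code with generator matrix G (rows G 0, ..., G (k-1))
  whose columns (vectors in F_q^k, represented as functions on {0..<k})
  consist of exactly one nonzero vector from each one-dimensional subspace
  of F_q^k.\<close>
definition dual_hamming_code :: "nat \<Rightarrow> ('a::{field,finite} ^ 'n::finite) set \<Rightarrow> bool" where
  "dual_hamming_code k D \<longleftrightarrow>
     CARD('n) = (CARD('a) ^ k - 1) div (CARD('a) - 1) \<and>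
     vec.dim D = k \<and>
     (\<exists>G :: nat \<Rightarrow> 'a ^ 'n.
        D = vec.span (G ` {0..<k}) \<and>
        (\<forall>j. \<exists>i<k. G i $ j \<noteq> 0) \<and>
        (\<forall>v :: nat \<Rightarrow> 'a. (\<exists>i<k. v i \<noteq> 0) \<longrightarrow>
            (\<exists>!j. \<exists>c. c \<noteq> 0 \<and> (\<forall>i<k. G i $ j = c * v i))))"

end

theory Submission
  imports Defs
begin

text \<open>Write a code C of dimension k as the row space of a k \<times> n matrix G and regard the columns
  of G as points of the projective space P^{k-1}. Then d(C^\<perp>) \<ge> 3 says exactly that the columns
  are nonzero and pairwise non-proportional, and covering dimension k says that C has no proper
  subspace of full support. If some point v is not a column, the hyperplane of C on which the
  functional G_i \<mapsto> v_i vanishes still has full support: a coordinate vanishing on it would give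
  a column proportional to v, or a zero column. Conversely, if every point is a column, each proper
  subspace lies in the kernel of a nonzero functional l, and the coordinate whose column is
  proportional to (l(G_i))_i vanishes on it. So \<gamma>(C) = k iff the columns are all points of
  P^{k-1}, each exactly once, i.e. iff C is a dual Hamming code; counting the columns gives its
  length.\<close>

interpretation functional: vector_space_pair
  "(*s) :: 'a::field \<Rightarrow> 'a^'n \<Rightarrow> 'a^'n" "(*) :: 'a \<Rightarrow> 'a \<Rightarrow> 'a"
  by unfold_locales

lemma linear_vec_nth:
  "Vector_Spaces.linear ((*s) :: 'a::field \<Rightarrow> 'a^'n \<Rightarrow> 'a^'n) (*) (\<lambda>x. x $ j)"
  unfolding Vector_Spaces.linear_iff
  by (auto simp: vec.vector_space_axioms vector_space_over_itself.vector_space_axioms)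

lemma linear_scaled_functional:
  "Vector_Spaces.linear ((*s) :: 'a::field \<Rightarrow> 'a^'n \<Rightarrow> 'a^'n) (*) l \<Longrightarrow>
   Vector_Spaces.linear ((*s) :: 'a \<Rightarrow> 'a^'n \<Rightarrow> 'a^'n) (*) (\<lambda>x. c * l x)"
  unfolding Vector_Spaces.linear_iff by (auto simp: algebra_simps)

lemma vec_nth_eq_scaled_functional_on_span:
  fixes G :: "'i \<Rightarrow> 'a::field^'n"
  assumes l: "Vector_Spaces.linear ((*s) :: 'a \<Rightarrow> 'a^'n \<Rightarrow> 'a^'n) (*) l"
    and x: "x \<in> vec.span (G ` I)" and G: "\<And>i. i \<in> I \<Longrightarrow> G i $ j = c * l (G i)"
  shows "x $ j = c * l x"
proof (rule functional.linear_eq_on[OF linear_vec_nth linear_scaled_functional[OF l] x])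
  show "b $ j = c * l b" if "b \<in> G ` I" for b
    using that G by blast
qed

lemma vec_nth_proportional_on_span:
  fixes G :: "'i \<Rightarrow> 'a::field^'n"
  assumes "x \<in> vec.span (G ` I)" and "\<And>i. i \<in> I \<Longrightarrow> G i $ j' = c * G i $ j"
  shows "x $ j' = c * x $ j"
  using vec_nth_eq_scaled_functional_on_span[OF linear_vec_nth assms] .

lemma exists_functional_extending:
  fixes B :: "('a::field^'n::finite) set"
  assumes "vec.independent B"
  obtains l where "Vector_Spaces.linear ((*s) :: 'a \<Rightarrow> 'a^'n \<Rightarrow> 'a^'n) (*) l"
    and "\<And>b. b \<in> B \<Longrightarrow> l b = f b"
  using functional.linear_construct[OF assms] functional.construct_basis[OF assms] by blast

lemma subspace_indexed_basis:
  fixes C :: "('a::field ^ 'n::finite) set"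
  assumes "vec.subspace C" and "vec.dim C = k"
  obtains G :: "nat \<Rightarrow> 'a^'n" where "C = vec.span (G ` {0..<k})"
    and "vec.independent (G ` {0..<k})" and "inj_on G {0..<k}"
proof -
  obtain B where B: "B \<subseteq> C" "vec.independent B" "C \<subseteq> vec.span B" "card B = vec.dim C"
    by (rule vec.basis_exists)
  have "finite B"
    using B(2) vec.finiteI_independent by blast
  then obtain G where G: "bij_betw G {0..<k} B"
    using ex_bij_betw_nat_finite B(4) assms(2) by metis
  have "vec.span B = C"
    using B(1,3) assms(1) vec.span_minimal by blast
  then show ?thesis
    using that G B(2) by (auto simp: bij_betw_def)
qed

lemma min_wt_le_wt:
  fixes C :: "('a::zero ^ 'n::finite) set"
  assumes "x \<in> C" and "x \<noteq> 0"
  shows "min_wt C \<le> wt x"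
proof -
  have "{wt x | x. x \<in> C \<and> x \<noteq> 0} \<subseteq> {..CARD('n)}"
    by (auto simp: wt_def intro!: card_mono)
  then have "finite {wt x | x. x \<in> C \<and> x \<noteq> 0}"
    using finite_subset by blast
  then show ?thesis
    unfolding min_wt_def using assms by (auto intro!: Min_le)
qed

lemma sum_mult_axis:
  "(\<Sum>l\<in>UNIV. (x::'a::comm_ring_1^'n::finite) $ l * axis j a $ l) = x $ j * a"
  by (simp add: axis_def if_distrib cong: if_cong)

lemma Supp_UNIV_if_min_wt_dual_ge_2:
  fixes C :: "('a::field ^ 'n::finite) set"
  assumes "min_wt (dual_code C) \<ge> 2"
  shows "Supp C = UNIV"
proof (rule ccontr)
  assume "Supp C \<noteq> UNIV"
  then obtain j where j: "\<forall>x\<in>C. x $ j = 0"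
    by (auto simp: Supp_def supp_def)
  let ?y = "axis j (1::'a)"
  have "?y \<in> dual_code C"
    using j by (simp add: dual_code_def sum_mult_axis)
  moreover have "?y \<noteq> 0"
    by (simp add: axis_eq_0_iff)
  moreover have "wt ?y = 1"
    by (simp add: wt_def supp_def axis_def)
  ultimately show False
    using min_wt_le_wt[of ?y "dual_code C"] assms by simp
qed

lemma coordinates_not_proportional_if_min_wt_dual_ge_3:
  fixes C :: "('a::field ^ 'n::finite) set"
  assumes "min_wt (dual_code C) \<ge> 3" and "j \<noteq> j'"
  shows "\<not> (\<forall>x\<in>C. x $ j' = c * x $ j)"
proof
  assume proportional: "\<forall>x\<in>C. x $ j' = c * x $ j"
  let ?y = "c *s axis j (1::'a) - axis j' 1"
  have "(\<Sum>l\<in>UNIV. x $ l * ?y $ l) = c * x $ j - x $ j'" for x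
    by (simp add: algebra_simps sum_subtractf sum_distrib_left[symmetric] sum_mult_axis)
  then have "?y \<in> dual_code C"
    using proportional by (simp add: dual_code_def)
  moreover have "?y \<noteq> 0"
    using assms(2) by (auto simp: vec_eq_iff axis_def)
  moreover have "wt ?y \<le> 2"
  proof -
    have "supp ?y \<subseteq> {j, j'}"
      by (auto simp: supp_def axis_def)
    then have "card (supp ?y) \<le> card {j, j'}"
      by (intro card_mono) auto
    also have "\<dots> \<le> 2"
      by (simp add: card_insert_if)
    finally show ?thesis
      by (simp add: wt_def)
  qed
  ultimately show False
    using min_wt_le_wt[of ?y "dual_code C"] assms(1) by simp
qed

lemma dim_pos_if_Supp_UNIV:
  fixes D :: "('a::field ^ 'n::finite) set"
  assumes "Supp D = UNIV"
  shows "vec.dim D > 0"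
proof -
  obtain x where "x \<in> D" "x $ undefined \<noteq> 0"
    using assms by (auto simp: Supp_def supp_def)
  then show ?thesis
    by (metis gr0I vec.dim_eq_0 singletonD subsetD zero_index)
qed

lemma dim_less_if_psubset:
  fixes C D :: "('a::field ^ 'n::finite) set"
  assumes "vec.subspace C" and "vec.subspace D" and "D \<subset> C"
  shows "vec.dim D < vec.dim C"
  by (metis assms vec.dim_psubset vec.span_eq_iff)

lemma covering_dim_eq_dim_iff:
  fixes C :: "('a::field ^ 'n::finite) set"
  assumes C: "vec.subspace C"
  shows "covering_dim C = enat (vec.dim C) \<longleftrightarrow>
    Supp C = UNIV \<and> (\<forall>D. vec.subspace D \<and> D \<subseteq> C \<and> Supp D = UNIV \<longrightarrow> D = C)"
proof -
  define P where
    "P = (\<lambda>r. r > 0 \<and> (\<exists>D. vec.subspace D \<and> D \<subseteq> C \<and> vec.dim D = r \<and> Supp D = UNIV))"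
  have cov: "covering_dim C = (if Supp C \<noteq> UNIV then \<infinity> else enat (LEAST r. P r))"
    by (simp add: covering_dim_def P_def)
  show ?thesis
  proof
    assume "covering_dim C = enat (vec.dim C)"
    then have SC: "Supp C = UNIV" and least: "(LEAST r. P r) = vec.dim C"
      by (simp_all add: cov split: if_splits)
    have "D = C" if D: "vec.subspace D" "D \<subseteq> C" "Supp D = UNIV" for D
    proof (rule ccontr)
      assume "D \<noteq> C"
      then have "vec.dim D < vec.dim C"
        using D C by (intro dim_less_if_psubset) auto
      moreover have "P (vec.dim D)"
        using D dim_pos_if_Supp_UNIV unfolding P_def by blast
      ultimately show False
        using Least_le[of P "vec.dim D"] least by simp
    qed
    with SC show "Supp C = UNIV \<and> (\<forall>D. vec.subspace D \<and> D \<subseteq> C \<and> Supp D = UNIV \<longrightarrow> D = C)"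
      by blast
  next
    assume SC: "Supp C = UNIV \<and> (\<forall>D. vec.subspace D \<and> D \<subseteq> C \<and> Supp D = UNIV \<longrightarrow> D = C)"
    have "(LEAST r. P r) = vec.dim C"
    proof (rule Least_equality)
      show "P (vec.dim C)"
        using SC C dim_pos_if_Supp_UNIV unfolding P_def by blast
      show "vec.dim C \<le> r" if "P r" for r
        using that SC unfolding P_def by auto
    qed
    then show "covering_dim C = enat (vec.dim C)"
      using SC by (simp add: cov)
  qed
qed

definition columns_cover_points :: "nat \<Rightarrow> (nat \<Rightarrow> 'a::field^'n) \<Rightarrow> bool" where
  "columns_cover_points k G \<longleftrightarrow>
     (\<forall>v. (\<exists>i<k. v i \<noteq> 0) \<longrightarrow> (\<exists>j c. c \<noteq> 0 \<and> (\<forall>i<k. G i $ j = c * v i)))"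

lemma coordinate_vanishing_on_kernel:
  fixes G :: "nat \<Rightarrow> 'a::field^'n::finite"
  assumes cover: "columns_cover_points k G"
    and l: "Vector_Spaces.linear ((*s) :: 'a \<Rightarrow> 'a^'n \<Rightarrow> 'a^'n) (*) l"
    and nonzero: "\<exists>i<k. l (G i) \<noteq> 0"
  obtains j where "\<And>x. x \<in> vec.span (G ` {0..<k}) \<Longrightarrow> l x = 0 \<Longrightarrow> x $ j = 0"
proof -
  obtain j c where col: "\<forall>i<k. G i $ j = c * l (G i)"
    using cover[unfolded columns_cover_points_def, rule_format, OF nonzero] by blast
  show ?thesis
  proof (rule that)
    fix x
    assume "x \<in> vec.span (G ` {0..<k})" and "l x = 0"
    have "x $ j = c * l x"
      using \<open>x \<in> _\<close> by (rule vec_nth_eq_scaled_functional_on_span[OF l]) (use col in simp)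
    with \<open>l x = 0\<close> show "x $ j = 0"
      by simp
  qed
qed

lemma exists_functional_vanishing_on_smaller_subspace:
  fixes C D :: "('a::field ^ 'n::finite) set"
  assumes D: "D \<subseteq> C" "vec.dim D < vec.dim C"
  obtains l x where "Vector_Spaces.linear ((*s) :: 'a \<Rightarrow> 'a^'n \<Rightarrow> 'a^'n) (*) l"
    and "\<And>y. y \<in> D \<Longrightarrow> l y = 0" and "x \<in> C" and "l x \<noteq> 0"
proof -
  obtain B' where B': "B' \<subseteq> D" "vec.independent B'" "D \<subseteq> vec.span B'"
    "card B' = vec.dim D"
    by (rule vec.basis_exists)
  obtain B where B: "B' \<subseteq> B" "B \<subseteq> C" "vec.independent B" "C \<subseteq> vec.span B"
    using vec.maximal_independent_subset_extend[of B' C] B' D by blast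
  have "card B = vec.dim C"
    using vec.basis_card_eq_dim[OF B(2,4,3)] .
  then have "B \<noteq> B'"
    using B'(4) D(2) by auto
  then obtain b where b: "b \<in> B" "b \<notin> B'"
    using B(1) by blast
  obtain l where l: "Vector_Spaces.linear ((*s) :: 'a \<Rightarrow> 'a^'n \<Rightarrow> 'a^'n) (*) l"
    and lB: "\<And>z. z \<in> B \<Longrightarrow> l z = (if z = b then 1 else 0)"
    using exists_functional_extending[OF B(3), where f = "\<lambda>z. if z = b then 1 else 0"]
    by blast
  interpret L: Vector_Spaces.linear "(*s) :: 'a \<Rightarrow> 'a^'n \<Rightarrow> 'a^'n" "(*)" l
    by (rule l)
  show ?thesis
  proof (rule that[OF l])
    show "l y = 0" if "y \<in> D" for y
    proof (rule L.eq_0_on_span)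
      show "l z = 0" if "z \<in> B'" for z
        using that b B(1) lB by auto
      show "y \<in> vec.span B'"
        using that B'(3) by blast
    qed
    show "b \<in> C" and "l b \<noteq> 0"
      using b(1) B(2) lB by auto
  qed
qed

lemma Supp_ne_UNIV_if_dim_less:
  fixes C :: "('a::field ^ 'n::finite) set" and G :: "nat \<Rightarrow> 'a^'n"
  assumes C: "C = vec.span (G ` {0..<k})" "vec.dim C = k"
    and cover: "columns_cover_points k G"
    and D: "D \<subseteq> C" "vec.dim D < k"
  shows "Supp D \<noteq> UNIV"
proof -
  obtain l x where l: "Vector_Spaces.linear ((*s) :: 'a \<Rightarrow> 'a^'n \<Rightarrow> 'a^'n) (*) l"
    and lD: "\<And>y. y \<in> D \<Longrightarrow> l y = 0" and x: "x \<in> C" "l x \<noteq> 0"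
    using exists_functional_vanishing_on_smaller_subspace[OF D(1)] D(2) C(2) by blast
  interpret L: Vector_Spaces.linear "(*s) :: 'a \<Rightarrow> 'a^'n \<Rightarrow> 'a^'n" "(*)" l
    by (rule l)
  have "\<exists>i<k. l (G i) \<noteq> 0"
  proof (rule ccontr)
    assume "\<not> ?thesis"
    then have "l z = 0" if "z \<in> G ` {0..<k}" for z
      using that by auto
    then have "l x = 0"
      using x(1) unfolding C(1) by (rule L.eq_0_on_span)
    then show False
      using x(2) by simp
  qed
  then obtain j where j: "\<And>y. y \<in> C \<Longrightarrow> l y = 0 \<Longrightarrow> y $ j = 0"
    using coordinate_vanishing_on_kernel[OF cover l] C(1) by blast
  then have "j \<notin> Supp D"
    using lD D(1) by (auto simp: Supp_def supp_def)
  then show ?thesis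
    by blast
qed

lemma Supp_hyperplane_eq_UNIV_if_point_missing:
  fixes C :: "('a::field ^ 'n::finite) set" and G :: "nat \<Rightarrow> 'a^'n"
  assumes C: "C = vec.span (G ` {0..<k})" and SC: "Supp C = UNIV"
    and l: "Vector_Spaces.linear ((*s) :: 'a \<Rightarrow> 'a^'n \<Rightarrow> 'a^'n) (*) l"
    and lG: "\<And>i. i < k \<Longrightarrow> l (G i) = v i"
    and x0: "x0 \<in> C" "l x0 = 1"
    and not_column: "\<nexists>j c. c \<noteq> 0 \<and> (\<forall>i<k. G i $ j = c * v i)"
  shows "Supp (C \<inter> {x. l x = 0}) = UNIV"
proof (rule ccontr)
  interpret L: Vector_Spaces.linear "(*s) :: 'a \<Rightarrow> 'a^'n \<Rightarrow> 'a^'n" "(*)" l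
    by (rule l)
  assume "Supp (C \<inter> {x. l x = 0}) \<noteq> UNIV"
  then obtain j where j: "\<forall>x\<in>C \<inter> {x. l x = 0}. x $ j = 0"
    by (auto simp: Supp_def supp_def)
  have col: "G i $ j = x0 $ j * v i" if "i < k" for i
  proof -
    have "G i \<in> C"
      unfolding C by (rule vec.span_base) (use that in simp)
    then have "G i - v i *s x0 \<in> C"
      using x0(1) C by (simp add: vec.subspace_diff vec.subspace_scale)
    moreover have "l (G i - v i *s x0) = 0"
      using that x0(2) by (simp add: L.diff L.scale lG)
    ultimately have "(G i - v i *s x0) $ j = 0"
      using j by blast
    then show ?thesis
      by (simp add: mult.commute)
  qed
  show False
  proof (cases "x0 $ j = 0")
    case True
    have "x $ j = 0 * l x" if "x \<in> C" for x
      using that unfolding C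
      by (rule vec_nth_eq_scaled_functional_on_span[OF l]) (use col True in simp)
    then have "j \<notin> Supp C"
      by (simp add: Supp_def supp_def)
    then show False
      using SC by blast
  next
    case False
    then show False
      using not_column col by blast
  qed
qed

lemma proper_full_support_subspace_if_point_missing:
  fixes C :: "('a::field ^ 'n::finite) set" and G :: "nat \<Rightarrow> 'a^'n"
  assumes C: "C = vec.span (G ` {0..<k})" "vec.independent (G ` {0..<k})" "inj_on G {0..<k}"
    and SC: "Supp C = UNIV"
    and v: "\<exists>i<k. v i \<noteq> 0" and not_column: "\<nexists>j c. c \<noteq> 0 \<and> (\<forall>i<k. G i $ j = c * v i)"
  shows "\<exists>D. vec.subspace D \<and> D \<subset> C \<and> Supp D = UNIV"
proof -
  obtain l where l: "Vector_Spaces.linear ((*s) :: 'a \<Rightarrow> 'a^'n \<Rightarrow> 'a^'n) (*) l"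
    and lG': "\<And>z. z \<in> G ` {0..<k} \<Longrightarrow> l z = v (the_inv_into {0..<k} G z)"
    using exists_functional_extending[OF C(2), where f = "\<lambda>z. v (the_inv_into {0..<k} G z)"]
    by blast
  have lG: "l (G i) = v i" if "i < k" for i
    using that lG' C(3) by (simp add: the_inv_into_f_f)
  interpret L: Vector_Spaces.linear "(*s) :: 'a \<Rightarrow> 'a^'n \<Rightarrow> 'a^'n" "(*)" l
    by (rule l)
  obtain i0 where i0: "i0 < k" "v i0 \<noteq> 0"
    using v by blast
  define x0 where "x0 = inverse (v i0) *s G i0"
  have sC: "vec.subspace C"
    using C(1) by simp
  have "G i0 \<in> C"
    unfolding C(1) by (rule vec.span_base) (use i0 in simp)
  then have x0: "x0 \<in> C" "l x0 = 1"
    unfolding x0_def using i0 sC by (simp_all add: L.scale lG vec.subspace_scale)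
  define D where "D = C \<inter> {x. l x = 0}"
  have "vec.subspace D"
    unfolding D_def by (intro vec.subspace_inter sC L.subspace_kernel)
  moreover have "D \<subset> C"
  proof
    show "D \<subseteq> C"
      by (simp add: D_def)
    have "x0 \<notin> D"
      using x0(2) by (simp add: D_def)
    then show "D \<noteq> C"
      using x0(1) by blast
  qed
  moreover have "Supp D = UNIV"
    unfolding D_def
    by (rule Supp_hyperplane_eq_UNIV_if_point_missing[OF C(1) SC l lG x0 not_column])
  ultimately show ?thesis
    by blast
qed

definition scaled_column :: "nat \<Rightarrow> (nat \<Rightarrow> 'a::field^'n) \<Rightarrow> 'n \<times> 'a \<Rightarrow> nat \<Rightarrow> 'a" where
  "scaled_column k G = (\<lambda>(j, c). restrict (\<lambda>i. c * G i $ j) {0..<k})"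

lemma inj_on_scaled_column:
  fixes G :: "nat \<Rightarrow> 'a::field^'n"
  assumes nonzero: "\<forall>j. \<exists>i<k. G i $ j \<noteq> 0"
    and not_proportional: "\<forall>j j' c. j \<noteq> j' \<longrightarrow> \<not> (\<forall>i<k. G i $ j' = c * G i $ j)"
  shows "inj_on (scaled_column k G) (UNIV \<times> (UNIV - {0}))"
proof (rule inj_onI)
  fix p p'
  assume "p \<in> UNIV \<times> (UNIV - {0})" "p' \<in> UNIV \<times> (UNIV - {0})"
    and eq: "scaled_column k G p = scaled_column k G p'"
  then obtain j c j' c' where p: "p = (j, c)" "p' = (j', c')" and "c \<noteq> 0" "c' \<noteq> 0"
    by auto
  have eq_i: "c * G i $ j = c' * G i $ j'" if "i < k" for i
    using fun_cong[OF eq, of i] that by (simp add: scaled_column_def p)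
  have "j = j'"
  proof (rule ccontr)
    assume "j \<noteq> j'"
    moreover have "\<forall>i<k. G i $ j' = (c / c') * G i $ j"
      using eq_i \<open>c' \<noteq> 0\<close> by (auto simp: field_simps)
    ultimately show False
      using not_proportional by blast
  qed
  moreover obtain i where "i < k" "G i $ j \<noteq> 0"
    using nonzero by blast
  ultimately show "p = p'"
    using eq_i[of i] by (simp add: p)
qed

lemma scaled_column_image:
  fixes G :: "nat \<Rightarrow> 'a::field^'n"
  assumes nonzero: "\<forall>j. \<exists>i<k. G i $ j \<noteq> 0" and cover: "columns_cover_points k G"
  shows "scaled_column k G ` (UNIV \<times> (UNIV - {0})) =
    PiE {0..<k} (\<lambda>_. UNIV) - {restrict (\<lambda>_. 0) {0..<k}}"
proof (intro equalityI subsetI)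
  fix w assume "w \<in> scaled_column k G ` (UNIV \<times> (UNIV - {0}))"
  then obtain j c where "c \<noteq> 0" and w: "w = scaled_column k G (j, c)"
    by auto
  moreover obtain i where "i < k" "G i $ j \<noteq> 0"
    using nonzero by blast
  ultimately have "w i \<noteq> 0"
    by (simp add: scaled_column_def)
  with \<open>i < k\<close> have "w \<noteq> restrict (\<lambda>_. 0) {0..<k}"
    by auto
  moreover have "w \<in> PiE {0..<k} (\<lambda>_. UNIV)"
    by (simp add: w scaled_column_def)
  ultimately show "w \<in> PiE {0..<k} (\<lambda>_. UNIV) - {restrict (\<lambda>_. 0) {0..<k}}"
    by blast
next
  fix w :: "nat \<Rightarrow> 'a"
  assume w: "w \<in> PiE {0..<k} (\<lambda>_. UNIV) - {restrict (\<lambda>_. 0) {0..<k}}"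
  then have "\<exists>i<k. w i \<noteq> 0"
    by (fastforce simp: PiE_def extensional_def fun_eq_iff split: if_split_asm)
  then obtain j c where "c \<noteq> 0" and "\<forall>i<k. G i $ j = c * w i"
    using cover unfolding columns_cover_points_def by blast
  then have "w = scaled_column k G (j, inverse c)"
    using w by (auto simp: scaled_column_def PiE_def extensional_def fun_eq_iff)
  with \<open>c \<noteq> 0\<close> show "w \<in> scaled_column k G ` (UNIV \<times> (UNIV - {0}))"
    by auto
qed

text \<open>Counting: the nonzero multiples of the columns are exactly the nonzero vectors of F_q^k.\<close>
lemma card_columns_eq:
  fixes G :: "nat \<Rightarrow> 'a::{field,finite}^'n::finite"
  assumes nonzero: "\<forall>j. \<exists>i<k. G i $ j \<noteq> 0"
    and not_proportional: "\<forall>j j' c. j \<noteq> j' \<longrightarrow> \<not> (\<forall>i<k. G i $ j' = c * G i $ j)"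
    and cover: "columns_cover_points k G"
  shows "CARD('n) = (CARD('a) ^ k - 1) div (CARD('a) - 1)"
proof -
  have "CARD('n) * (CARD('a) - 1) = card (UNIV \<times> (UNIV - {0::'a}) :: ('n \<times> 'a) set)"
    by (simp add: card_cartesian_product card_Diff_singleton)
  also have "\<dots> = card (PiE {0..<k} (\<lambda>_. UNIV :: 'a set) - {restrict (\<lambda>_. 0) {0..<k}})"
    using card_image[OF inj_on_scaled_column[OF nonzero not_proportional]]
      scaled_column_image[OF nonzero cover] by simp
  also have "\<dots> = CARD('a) ^ k - 1"
    by (simp add: card_Diff_singleton card_PiE)
  finally have count: "CARD('n) * (CARD('a) - 1) = CARD('a) ^ k - 1" .
  have "CARD('a) \<ge> 2"
    using card_mono[of UNIV "{0::'a, 1}"] by simp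
  then show ?thesis
    using count[symmetric] by simp
qed

definition monomial_map :: "('n \<Rightarrow> 'n) \<Rightarrow> ('n \<Rightarrow> 'a) \<Rightarrow> 'a::field^'n::finite \<Rightarrow> 'a^'n" where
  "monomial_map \<sigma> s x = (\<chi> j. s j * x $ \<sigma> j)"

lemma linear_monomial_map: "Vector_Spaces.linear (*s) (*s) (monomial_map \<sigma> s)"
  unfolding Vector_Spaces.linear_iff monomial_map_def
  by (auto simp: vec.vector_space_axioms vec_eq_iff algebra_simps)

lemma monomial_map_inverse:
  assumes "bij \<sigma>" and "\<forall>j. s j \<noteq> 0"
  shows "monomial_map (inv \<sigma>) (\<lambda>j. inverse (s (inv \<sigma> j))) (monomial_map \<sigma> s x) = x"
  using assms by (simp add: monomial_map_def vec_eq_iff bij_is_surj surj_f_inv_f)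

lemma Supp_monomial_map_image:
  assumes "\<forall>j. s j \<noteq> 0"
  shows "Supp (monomial_map \<sigma> s ` S) = \<sigma> -` Supp S"
  using assms by (auto simp: Supp_def supp_def monomial_map_def)

lemma full_support_subspace_monomial_map_image:
  fixes C :: "('a::field^'n::finite) set"
  assumes \<sigma>: "bij \<sigma>" and s: "\<forall>j. s j \<noteq> 0"
    and D: "vec.subspace D" "D \<subseteq> C" "Supp D = UNIV"
  shows "\<exists>D'. vec.subspace D' \<and> D' \<subseteq> monomial_map \<sigma> s ` C \<and> vec.dim D' = vec.dim D \<and>
    Supp D' = UNIV"
proof (intro exI conjI)
  interpret T: Vector_Spaces.linear "(*s)" "(*s)" "monomial_map \<sigma> s"
    by (rule linear_monomial_map)
  have "inj (monomial_map \<sigma> s)"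
    using monomial_map_inverse[OF \<sigma> s] by (metis injI)
  then show "vec.dim (monomial_map \<sigma> s ` D) = vec.dim D"
    using vec.dim_image_eq[OF linear_monomial_map] by (metis inj_on_subset subset_UNIV)
  show "vec.subspace (monomial_map \<sigma> s ` D)"
    using D(1) T.subspace_image by blast
  show "monomial_map \<sigma> s ` D \<subseteq> monomial_map \<sigma> s ` C"
    using D(2) by blast
  show "Supp (monomial_map \<sigma> s ` D) = UNIV"
    using D(3) s by (simp add: Supp_monomial_map_image)
qed

lemma covering_dim_monomial_map_image:
  fixes C :: "('a::field^'n::finite) set"
  assumes \<sigma>: "bij \<sigma>" and s: "\<forall>j. s j \<noteq> 0"
  shows "covering_dim (monomial_map \<sigma> s ` C) = covering_dim C"
proof -
  define \<tau> t where "\<tau> = inv \<sigma>" and "t = (\<lambda>j. inverse (s (inv \<sigma> j)))"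
  have \<tau>: "bij \<tau>" and t: "\<forall>j. t j \<noteq> 0"
    using \<sigma> s by (simp_all add: \<tau>_def t_def bij_imp_bij_inv)
  have C: "C = monomial_map \<tau> t ` (monomial_map \<sigma> s ` C)"
    using monomial_map_inverse[OF \<sigma> s] by (simp add: \<tau>_def t_def image_image)
  have "\<sigma> -` A = UNIV \<longleftrightarrow> A = UNIV" for A
    by (metis bij_is_surj[OF \<sigma>] image_vimage_eq inf_top.right_neutral vimage_UNIV)
  then have "Supp (monomial_map \<sigma> s ` C) = UNIV \<longleftrightarrow> Supp C = UNIV"
    using s by (simp add: Supp_monomial_map_image)
  moreover have
    "(\<exists>D. vec.subspace D \<and> D \<subseteq> monomial_map \<sigma> s ` C \<and> vec.dim D = r \<and> Supp D = UNIV) \<longleftrightarrow>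
     (\<exists>D. vec.subspace D \<and> D \<subseteq> C \<and> vec.dim D = r \<and> Supp D = UNIV)" for r
  proof
    assume "\<exists>D. vec.subspace D \<and> D \<subseteq> monomial_map \<sigma> s ` C \<and> vec.dim D = r \<and> Supp D = UNIV"
    then show "\<exists>D. vec.subspace D \<and> D \<subseteq> C \<and> vec.dim D = r \<and> Supp D = UNIV"
      using full_support_subspace_monomial_map_image[OF \<tau> t, of _ "monomial_map \<sigma> s ` C"] C by metis
  next
    assume "\<exists>D. vec.subspace D \<and> D \<subseteq> C \<and> vec.dim D = r \<and> Supp D = UNIV"
    then show "\<exists>D. vec.subspace D \<and> D \<subseteq> monomial_map \<sigma> s ` C \<and> vec.dim D = r \<and> Supp D = UNIV"
      using full_support_subspace_monomial_map_image[OF \<sigma> s, of _ C] by metis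
  qed
  ultimately show ?thesis
    unfolding covering_dim_def by simp
qed

lemma covering_dim_monomially_equivalent:
  fixes C :: "('a::field^'n::finite) set"
  assumes "monomially_equivalent C D"
  shows "covering_dim C = covering_dim D"
proof -
  obtain \<sigma> s where "bij \<sigma>" "\<forall>j. s j \<noteq> 0" "D = monomial_map \<sigma> s ` C"
    using assms unfolding monomially_equivalent_def monomial_map_def[abs_def] by blast
  then show ?thesis
    by (simp add: covering_dim_monomial_map_image)
qed

lemma monomially_equivalent_refl: "monomially_equivalent C C"
  unfolding monomially_equivalent_def
  by (rule exI[of _ id], rule exI[of _ "\<lambda>_. 1"]) (simp add: vec_eq_iff)

lemma columns_nonzero_if_Supp_UNIV:
  fixes G :: "nat \<Rightarrow> 'a::field^'n::finite"
  assumes "Supp (vec.span (G ` {0..<k})) = UNIV"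
  shows "\<forall>j. \<exists>i<k. G i $ j \<noteq> 0"
proof (rule ccontr)
  assume "\<not> ?thesis"
  then obtain j where col: "\<forall>i<k. G i $ j = 0 * G i $ j"
    by auto
  have "x $ j = 0 * x $ j" if "x \<in> vec.span (G ` {0..<k})" for x
    using that by (rule vec_nth_proportional_on_span) (use col in simp)
  then have "j \<notin> Supp (vec.span (G ` {0..<k}))"
    by (simp add: Supp_def supp_def)
  then show False
    using assms by blast
qed

lemma columns_not_proportional_if_min_wt_dual_ge_3:
  fixes G :: "nat \<Rightarrow> 'a::field^'n::finite"
  assumes "min_wt (dual_code (vec.span (G ` {0..<k}))) \<ge> 3"
  shows "\<forall>j j' c. j \<noteq> j' \<longrightarrow> \<not> (\<forall>i<k. G i $ j' = c * G i $ j)"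
proof (intro allI impI notI)
  fix j j' c
  assume "j \<noteq> j'" and col: "\<forall>i<k. G i $ j' = c * G i $ j"
  have "\<forall>x\<in>vec.span (G ` {0..<k}). x $ j' = c * x $ j"
  proof
    show "x $ j' = c * x $ j" if "x \<in> vec.span (G ` {0..<k})" for x
      using that by (rule vec_nth_proportional_on_span) (use col in simp)
  qed
  then show False
    using coordinates_not_proportional_if_min_wt_dual_ge_3[OF assms \<open>j \<noteq> j'\<close>] by blast
qed

lemma ex1_column_if_not_proportional:
  fixes G :: "nat \<Rightarrow> 'a::field^'n"
  assumes not_proportional: "\<forall>j j' c. j \<noteq> j' \<longrightarrow> \<not> (\<forall>i<k. G i $ j' = c * G i $ j)"
    and "\<exists>j c. c \<noteq> 0 \<and> (\<forall>i<k. G i $ j = c * v i)"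
  shows "\<exists>!j. \<exists>c. c \<noteq> 0 \<and> (\<forall>i<k. G i $ j = c * v i)"
proof (rule ex_ex1I)
  show "\<exists>j c. c \<noteq> 0 \<and> (\<forall>i<k. G i $ j = c * v i)"
    by fact
next
  fix j1 j2
  assume "\<exists>c. c \<noteq> 0 \<and> (\<forall>i<k. G i $ j1 = c * v i)" "\<exists>c. c \<noteq> 0 \<and> (\<forall>i<k. G i $ j2 = c * v i)"
  then obtain c1 c2 where "c1 \<noteq> 0" "\<forall>i<k. G i $ j1 = c1 * v i" "\<forall>i<k. G i $ j2 = c2 * v i"
    by blast
  then have "\<forall>i<k. G i $ j2 = (c2 / c1) * G i $ j1"
    by auto
  then show "j1 = j2"
    using not_proportional by blast
qed

lemma dual_hamming_code_if_covering_dim_eq: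
  fixes C :: "('a::{field,finite} ^ 'n::finite) set"
  assumes C: "vec.subspace C" "vec.dim C = k"
    and dual_distance: "min_wt (dual_code C) \<ge> 3"
    and cov: "covering_dim C = enat k"
  shows "dual_hamming_code k C"
proof -
  obtain G where G: "C = vec.span (G ` {0..<k})" "vec.independent (G ` {0..<k})"
    "inj_on G {0..<k}"
    using subspace_indexed_basis[OF C] .
  have SC: "Supp C = UNIV"
    using dual_distance by (intro Supp_UNIV_if_min_wt_dual_ge_2) simp
  have maximal: "\<forall>D. vec.subspace D \<and> D \<subseteq> C \<and> Supp D = UNIV \<longrightarrow> D = C"
    using covering_dim_eq_dim_iff[OF C(1)] cov C(2) by simp
  have cover: "columns_cover_points k G"
    unfolding columns_cover_points_def
  proof (intro allI impI, rule ccontr)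
    fix v :: "nat \<Rightarrow> 'a"
    assume "\<exists>i<k. v i \<noteq> 0" and "\<nexists>j c. c \<noteq> 0 \<and> (\<forall>i<k. G i $ j = c * v i)"
    then obtain D where "vec.subspace D" "D \<subset> C" "Supp D = UNIV"
      using proper_full_support_subspace_if_point_missing[OF G SC] by blast
    then show False
      using maximal by blast
  qed
  have nonzero: "\<forall>j. \<exists>i<k. G i $ j \<noteq> 0"
    using columns_nonzero_if_Supp_UNIV SC G(1) by blast
  have not_proportional: "\<forall>j j' c. j \<noteq> j' \<longrightarrow> \<not> (\<forall>i<k. G i $ j' = c * G i $ j)"
    using columns_not_proportional_if_min_wt_dual_ge_3 dual_distance G(1) by blast
  have "\<exists>!j. \<exists>c. c \<noteq> 0 \<and> (\<forall>i<k. G i $ j = c * v i)" if "\<exists>i<k. v i \<noteq> 0" for v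
    using ex1_column_if_not_proportional[OF not_proportional] cover that
    unfolding columns_cover_points_def by blast
  then show ?thesis
    unfolding dual_hamming_code_def
    using card_columns_eq[OF nonzero not_proportional cover] C(2) G(1) nonzero
    by (intro conjI exI[of _ G]) simp_all
qed

lemma covering_dim_dual_hamming_code:
  fixes D :: "('a::{field,finite} ^ 'n::finite) set"
  assumes "dual_hamming_code k D"
  shows "covering_dim D = enat k"
proof -
  obtain G where dim: "vec.dim D = k" and G: "D = vec.span (G ` {0..<k})"
    and nonzero: "\<forall>j. \<exists>i<k. G i $ j \<noteq> 0"
    and unique: "\<forall>v. (\<exists>i<k. v i \<noteq> 0) \<longrightarrow> (\<exists>!j. \<exists>c. c \<noteq> 0 \<and> (\<forall>i<k. G i $ j = c * v i))"
    using assms unfolding dual_hamming_code_def by (elim conjE exE) (rule that)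
  have cover: "columns_cover_points k G"
    unfolding columns_cover_points_def
  proof (intro allI impI)
    fix v :: "nat \<Rightarrow> 'a"
    assume "\<exists>i<k. v i \<noteq> 0"
    then show "\<exists>j c. c \<noteq> 0 \<and> (\<forall>i<k. G i $ j = c * v i)"
      using ex1_implies_ex[OF unique[rule_format]] by blast
  qed
  have sD: "vec.subspace D"
    using G by simp
  have "j \<in> Supp D" for j
  proof -
    obtain i where "i < k" "G i $ j \<noteq> 0"
      using nonzero by blast
    moreover have "G i \<in> D"
      unfolding G by (rule vec.span_base) (use \<open>i < k\<close> in simp)
    ultimately show ?thesis
      by (auto simp: Supp_def supp_def)
  qed
  then have "Supp D = UNIV"
    by blast
  moreover have "D' = D" if D': "vec.subspace D'" "D' \<subseteq> D" "Supp D' = UNIV" for D'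
  proof (rule ccontr)
    assume "D' \<noteq> D"
    then have "vec.dim D' < k"
      using D' dim_less_if_psubset[OF sD D'(1)] dim by blast
    then show False
      using Supp_ne_UNIV_if_dim_less[OF G dim cover D'(2)] D'(3) by blast
  qed
  ultimately show ?thesis
    using covering_dim_eq_dim_iff[OF sD] dim by simp
qed

theorem mainTheorem4:
  fixes C :: "('a::{field,finite} ^ 'n::finite) set"
    and k :: nat
  assumes "vec.subspace C"
    and "vec.dim C = k"
    and "min_wt (dual_code C) = 3"
  shows "covering_dim C = enat k \<longleftrightarrow>
         (\<exists>D. dual_hamming_code k D \<and> monomially_equivalent C D)"
proof
  assume cov: "covering_dim C = enat k"
  \<comment> \<open>Being a dual Hamming code does not fix the order or scaling of the columns, so C is its own witness.\<close>
  have "dual_hamming_code k C"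
    by (rule dual_hamming_code_if_covering_dim_eq[OF assms(1,2) _ cov]) (simp add: assms(3))
  then show "\<exists>D. dual_hamming_code k D \<and> monomially_equivalent C D"
    by (intro exI[of _ C] conjI monomially_equivalent_refl)
next
  assume "\<exists>D. dual_hamming_code k D \<and> monomially_equivalent C D"
  then obtain D where D: "dual_hamming_code k D" and CD: "monomially_equivalent C D"
    by blast
  show "covering_dim C = enat k"
    unfolding covering_dim_monomially_equivalent[OF CD] by (rule covering_dim_dual_hamming_code[OF D])
qed

end
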